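(* Let $J(n,k)$ be the Johnson graph with $4\leq 2k\leq n$. Then $$\dim_f(J(n,k))=\begin{cases}3, & (n,k)=(4,2),\\ \frac{35}{17}, & (n,k)=(8,4),\\ \frac{n^2-n}{2kn-2k^2}, & \text{otherwise.}\end{cases}$$
   Context: For a set $X$ of size $n$, the Johnson graph $J(n,k)$ has the $k$-subsets of $X$ as vertices, two $k$-subsets being adjacent iff their intersection has size $k-1$. For vertices $x,y$ of a connected graph $G$, $R\{x,y\}$ is the set of vertices $z$ with $d(x,z)\neq d(y,z)$. A resolving function of $G$ is $f:V(G)\to[0,1]$ with $\sum_{z\in R\{x,y\}}f(z)\geq 1$ for all distinct $x,y$; $\dim_f(G)$ is the minimum of $\sum_{v\in V(G)}f(v)$ over all resolving functions $f$. *)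

theory Defs
  imports Complex_Main "Graph_Theory.Graph_Theory"
begin

text \<open>Undirected simple graphs are symmetric loop-free digraphs, as in the locale \<^locale>\<open>graph\<close>.\<close>

text \<open>The least number of arcs of a walk from \<open>x\<close> to \<open>y\<close>.  The constant
  \<open>wf_digraph.\<mu>\<close> takes values in the extended reals and is infinite if no walk exists.\<close>

definition graph_dist :: "('a, 'b) pre_digraph \<Rightarrow> 'a \<Rightarrow> 'a \<Rightarrow> ereal" where
  "graph_dist G x y = wf_digraph.\<mu> G (\<lambda>_. 1) x y"

definition resolving_set :: "('a, 'b) pre_digraph \<Rightarrow> 'a \<Rightarrow> 'a \<Rightarrow> 'a set" where
  "resolving_set G x y = {z \<in> verts G. graph_dist G x z \<noteq> graph_dist G y z}"

definition resolving_function :: "('a, 'b) pre_digraph \<Rightarrow> ('a \<Rightarrow> real) \<Rightarrow> bool" where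
  "resolving_function G f \<longleftrightarrow>
     (\<forall>v\<in>verts G. 0 \<le> f v \<and> f v \<le> 1) \<and>
     (\<forall>x\<in>verts G. \<forall>y\<in>verts G. x \<noteq> y \<longrightarrow> (\<Sum>z\<in>resolving_set G x y. f z) \<ge> 1)"

text \<open>\<open>LEAST\<close> is the minimum, not the infimum: an equation \<open>frac_metric_dim G = c\<close> can
  be derived only by showing that some resolving function attains \<open>c\<close>.\<close>

definition frac_metric_dim :: "('a, 'b) pre_digraph \<Rightarrow> real" where
  "frac_metric_dim G = (LEAST s. \<exists>f. resolving_function G f \<and> s = (\<Sum>v\<in>verts G. f v))"

text \<open>Adjacency is written \<open>card (A \<inter> B) + 1 = k\<close> rather than with \<open>k - 1\<close>, since truncated
  subtraction would create a loop for \<open>k = 0\<close>.\<close>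

definition johnson_graph :: "'a set \<Rightarrow> nat \<Rightarrow> 'a set pair_pre_digraph" where
  "johnson_graph X k =
     \<lparr> pverts = {A. A \<subseteq> X \<and> card A = k},
       parcs = {(A, B). A \<subseteq> X \<and> card A = k \<and> B \<subseteq> X \<and> card B = k \<and> card (A \<inter> B) + 1 = k} \<rparr>"

lemma pverts_johnson_graph: "A \<in> pverts (johnson_graph X k) \<longleftrightarrow> A \<subseteq> X \<and> card A = k"
  by (simp add: johnson_graph_def)

lemma parcs_johnson_graph:
  "(A, B) \<in> parcs (johnson_graph X k) \<longleftrightarrow>
     A \<in> pverts (johnson_graph X k) \<and> B \<in> pverts (johnson_graph X k) \<and> card (A \<inter> B) + 1 = k"
  by (simp add: johnson_graph_def)

lemma pair_graph_johnson_graph: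
  assumes "finite X"
  shows "pair_graph (johnson_graph X k)"
proof -
  let ?J = "johnson_graph X k"
  have "pverts ?J \<subseteq> Pow X"
    by (rule subsetI) (simp only: pverts_johnson_graph Pow_iff)
  then have fin: "finite (pverts ?J)"
    by (rule finite_subset) (simp only: finite_Pow_iff assms)
  have sub: "e \<in> pverts ?J \<times> pverts ?J" if "e \<in> parcs ?J" for e
    using that by (cases e) (simp only: parcs_johnson_graph mem_Sigma_iff simp_thms)
  then have fin': "finite (parcs ?J)"
    by (intro finite_subset[OF subsetI finite_cartesian_product[OF fin fin]])
  have "sym (parcs ?J)"
    by (rule symI) (simp only: parcs_johnson_graph Int_commute simp_thms)
  then have sym: "symmetric (with_proj ?J)"
    by (simp only: symmetric_def with_proj_simps)
  have loopfree: "fst e \<noteq> snd e" if "e \<in> parcs ?J" for e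
    using that by (cases e) (auto simp only: parcs_johnson_graph pverts_johnson_graph Int_absorb fst_conv snd_conv)
  show ?thesis
  proof unfold_locales
    fix e assume e: "e \<in> parcs ?J"
    show "fst e \<in> pverts ?J" "snd e \<in> pverts ?J"
      using sub[OF e] by (simp_all only: mem_Times_iff)
    show "fst e \<noteq> snd e"
      by (rule loopfree[OF e])
  qed (rule fin fin' sym)+
qed

end

theory Submission
  imports Defs "HOL-Computational_Algebra.Formal_Power_Series"
begin

text \<open>
  The distance of two \<open>k\<close>-sets is \<open>d(A, B) = card (A - B)\<close>, so \<open>z\<close> fails to resolve
  \<open>A, B\<close> iff \<open>z\<close> meets \<open>A - B\<close> and \<open>B - A\<close> in equally many points, and the number of such \<open>z\<close>
  depends only on \<open>n\<close>, \<open>k\<close> and \<open>j = card (A - B)\<close>.  By transitivity of the symmetric group on the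
  vertices, averaging the constraints over all pairs at a distance \<open>j\<close> for which the resolving
  sets are smallest shows that a constant function is optimal.  The dimension is
  therefore the number of vertices divided by the least size of a resolving set, and it remains to show that
  \<open>j = 1\<close> maximises the number of unresolved sets, with the two exceptions.

  Conditioning on \<open>z \<inter> S\<close> for a set \<open>S\<close> containing the symmetric difference of \<open>A\<close> and \<open>B\<close>
  reduces the comparison with \<open>j = 1\<close> to \<open>n = card S\<close>.  For \<open>j \<ge> 6\<close> one takes \<open>card S = 2 * j\<close>
  and needs \<open>(j choose i)\<^sup>2 \<le> ((2 * j - 2) choose (2 * i)) + ((2 * j - 2) choose (2 * i - 2))\<close>, which follows
  from the identity \<open>(j choose i)\<^sup>2 / ((2 * j) choose (2 * i)) = c i * c (j - i) / c j\<close>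
  with \<open>c a = (2 * a) choose a\<close>.  For \<open>2 \<le> j \<le> 5\<close>
  one takes \<open>card S = 2 * j + 1\<close>, which leaves only \<open>n = 2 * k = 2 * j\<close>: there no \<open>z\<close> is
  unresolved for odd \<open>k\<close>, and \<open>k = 2, 4\<close> are the exceptions.
\<close>

section \<open>Inequalities for binomial coefficients\<close>

text \<open>Absorption is applied twice, with the symmetry of row \<open>Suc (2 * a)\<close> in
  between; the extra factor \<open>Suc a\<close> is cancelled at the end.\<close>

lemma central_binomial_Suc:
  "Suc a * ((2 * Suc a) choose Suc a) = 2 * (2 * a + 1) * ((2 * a) choose a)"
proof -
  have "Suc a * (Suc a * ((2 * Suc a) choose Suc a)) = Suc a * (2 * Suc a * (Suc (2 * a) choose a))"
    using Suc_times_binomial_eq[of "Suc (2 * a)" a] by (simp add: mult_ac)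
  also have "Suc (2 * a) choose a = Suc (2 * a) choose Suc a"
    by (subst binomial_symmetric) auto
  also have "Suc a * (2 * Suc a * (Suc (2 * a) choose Suc a)) = 2 * Suc a * (Suc (2 * a) * ((2 * a) choose a))"
    using Suc_times_binomial_eq[of "2 * a" a] by (simp only: mult_ac)
  finally have "Suc a * (Suc a * ((2 * Suc a) choose Suc a)) = Suc a * (2 * (2 * a + 1) * ((2 * a) choose a))"
    by (simp only: mult_ac Suc_eq_plus1)
  then show ?thesis
    by (metis mult_cancel1 nat.distinct(1))
qed

text \<open>With A = a and J = j as reals, the left-hand side grows by the factor 2(2A+1)(2J+1) /
  ((A+1)(2J-1)) and the right-hand side by 2J(2J+1) / ((J-1)(J+1)). The fact \<open>poly\<close>
  compares the two.\<close>

lemma central_binomial_product_step: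
  assumes b: "b \<ge> 1" and j: "j = a + b"
    and IH: "(2 * j - 1) * (((2 * a) choose a) * ((2 * b) choose b)) \<le> (j - 1) * ((2 * j) choose j)"
  shows "(2 * Suc j - 1) * (((2 * Suc a) choose Suc a) * ((2 * b) choose b))
    \<le> (Suc j - 1) * ((2 * Suc j) choose Suc j)"
proof -
  define J A p q r p' r' where "J = real j" and "A = real a" and "p = real ((2 * a) choose a)" and "q = real ((2 * b) choose b)"
    and "r = real ((2 * j) choose j)" and "p' = real ((2 * Suc a) choose Suc a)" and "r' = real ((2 * Suc j) choose Suc j)"
  have J: "J \<ge> A + 1" "A \<ge> 0" using b by (simp_all add: J_def A_def j)
  have nn: "p \<ge> 0" "q \<ge> 0" "r \<ge> 0" by (simp_all add: p_def q_def r_def)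
  have "real ((2 * j - 1) * (((2 * a) choose a) * ((2 * b) choose b))) \<le> real ((j - 1) * ((2 * j) choose j))"
    using IH by (rule of_nat_mono)
  then have IH': "(2 * J - 1) * (p * q) \<le> (J - 1) * r"
    using b j by (simp add: of_nat_diff J_def p_def q_def r_def)
  have "real (Suc a * ((2 * Suc a) choose Suc a)) = real (2 * (2 * a + 1) * ((2 * a) choose a))"
    by (simp only: central_binomial_Suc)
  then have p': "p' = 2 * (2 * A + 1) * p / (A + 1)"
    using J by (simp add: p'_def p_def A_def field_simps del: binomial_Suc_Suc mult_Suc_right)
  have "real (Suc j * ((2 * Suc j) choose Suc j)) = real (2 * (2 * j + 1) * ((2 * j) choose j))"
    by (simp only: central_binomial_Suc)
  then have r': "r' = 2 * (2 * J + 1) * r / (J + 1)"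
    using J by (simp add: r'_def r_def J_def field_simps del: binomial_Suc_Suc mult_Suc_right)
  have poly: "(J - 1) * (2 * A + 1) * (J + 1) \<le> J * (2 * J - 1) * (A + 1)"
  proof -
    have "J * (2 * J - 1) * (A + 1) - (J - 1) * (2 * A + 1) * (J + 1) = J * (J - A - 1) + 2 * A + 1"
      by (simp add: algebra_simps)
    moreover have "J * (J - A - 1) \<ge> 0" using J by simp
    ultimately show ?thesis using J by linarith
  qed
  have "(2 * J - 1) * ((2 * A + 1) * (p * q) * (J + 1)) = (2 * J - 1) * (p * q) * ((2 * A + 1) * (J + 1))"
    by (simp add: mult_ac)
  also have "\<dots> \<le> (J - 1) * r * ((2 * A + 1) * (J + 1))"
    using IH' J by (intro mult_right_mono) auto
  also have "\<dots> = (J - 1) * (2 * A + 1) * (J + 1) * r" by (simp add: mult_ac)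
  also have "\<dots> \<le> J * (2 * J - 1) * (A + 1) * r"
    using poly nn(3) by (rule mult_right_mono)
  also have "\<dots> = (2 * J - 1) * (J * (A + 1) * r)" by (simp add: mult_ac)
  finally have *: "(2 * A + 1) * (p * q) * (J + 1) \<le> J * (A + 1) * r"
    using J by simp
  have "(2 * J + 1) * (p' * q) = 2 * (2 * J + 1) / ((A + 1) * (J + 1)) * ((2 * A + 1) * (p * q) * (J + 1))"
    unfolding p' using J by (simp add: divide_simps) (simp add: algebra_simps)
  also have "\<dots> \<le> 2 * (2 * J + 1) / ((A + 1) * (J + 1)) * (J * (A + 1) * r)"
    using * J by (intro mult_left_mono) auto
  also have "\<dots> = J * r'"
    unfolding r' using J by (simp add: divide_simps)
  finally have "real ((2 * Suc j - 1) * (((2 * Suc a) choose Suc a) * ((2 * b) choose b)))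
      \<le> real ((Suc j - 1) * ((2 * Suc j) choose Suc j))"
    by (simp add: J_def p'_def q_def r'_def add.commute del: binomial_Suc_Suc mult_Suc_right)
  then show ?thesis by (simp only: of_nat_le_iff)
qed

text \<open>The constant \<open>6\<close> is sharp: for \<open>a = 2\<close> and \<open>b = 4\<close> equality holds.\<close>

lemma central_binomial_product_le:
  assumes "a \<ge> 2" "b \<ge> 2" "j = a + b" "j \<ge> 6"
  shows "(2 * j - 1) * (((2 * a) choose a) * ((2 * b) choose b)) \<le> (j - 1) * ((2 * j) choose j)"
  using assms(4,1-3)
proof (induction j arbitrary: a b rule: nat_induct_at_least)
  case base
  then have "(a, b) = (2, 4) \<or> (a, b) = (3, 3) \<or> (a, b) = (4, 2)" by auto
  moreover have "(2 * 2) choose 2 = (6::nat)" "(2 * 3) choose 3 = (20::nat)" "(2 * 4) choose 4 = (70::nat)"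
    "(2 * 6) choose 6 = (924::nat)" by (simp_all add: binomial_fact' fact_numeral)
  ultimately show ?case by auto
next
  case (Suc j)
  show ?case
  \<comment> \<open>One of \<open>a\<close> and \<open>b\<close> can be lowered without falling
    below 2: if \<open>a = 2\<close>, then \<open>b \<ge> 5\<close> because
    \<open>Suc j \<ge> 7\<close>.\<close>
  proof (cases "a \<ge> 3")
    case True
    then obtain a' where a': "a = Suc a'" by (cases a) auto
    show ?thesis unfolding a'
      by (rule central_binomial_product_step, use Suc.prems a' True in simp, use Suc.prems a' in simp,
          rule Suc.IH, use Suc.prems a' True in auto)
  next
    case False
    then obtain b' where b': "b = Suc b'" using Suc.prems Suc.hyps by (cases b) auto
    show ?thesis unfolding b'
      by (subst mult.commute[of "(2 * a) choose a"], rule central_binomial_product_step,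
          use Suc.prems b' in simp, use Suc.prems b' in simp, subst mult.commute[of "(2 * b') choose b'"],
          rule Suc.IH, use Suc.prems Suc.hyps b' False in auto)
  qed
qed

text \<open>Both sides equal (2j)! / (a! b!)^2.\<close>

lemma binomial_square_central:
  assumes "j = a + b"
  shows "(j choose a)\<^sup>2 * ((2 * j) choose j) = ((2 * j) choose (2 * a)) * (((2 * a) choose a) * ((2 * b) choose b))"
proof -
  have f: "real (m + n choose m) = fact (m + n) / (fact m * fact n)" for m n
    by (simp add: binomial_fact)
  have "2 * (a + b) = 2 * a + 2 * b" by simp
  then have "real ((2 * j) choose (2 * a)) = fact (2 * a + 2 * b) / (fact (2 * a) * fact (2 * b))"
    using f[of "2 * a" "2 * b"] assms by simp
  moreover have "real ((2 * j) choose j) = fact (2 * a + 2 * b) / (fact j * fact j)"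
    using f[of j j] assms by (simp add: mult_2 add_ac)
  moreover have "real ((2 * a) choose a) = fact (2 * a) / (fact a * fact a)"
    using f[of a a] by (simp add: mult_2)
  moreover have "real ((2 * b) choose b) = fact (2 * b) / (fact b * fact b)"
    using f[of b b] by (simp add: mult_2)
  moreover have "real (j choose a) = fact j / (fact a * fact b)"
    using f[of a b] assms by simp
  ultimately have "real ((j choose a)\<^sup>2 * ((2 * j) choose j)) =
    real (((2 * j) choose (2 * a)) * (((2 * a) choose a) * ((2 * b) choose b)))"
    by (simp only: of_nat_mult of_nat_power) (simp add: power2_eq_square divide_simps)
  then show ?thesis by (simp only: of_nat_eq_iff)
qed

lemma binomial_pair_split:
  "(Suc (Suc n) choose Suc (Suc m)) = (n choose Suc (Suc m)) + 2 * (n choose Suc m) + (n choose m)"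
  by simp

text \<open>With n = m + d + 2 and k = m + 1 this relates (n - 2 choose k - 1) to (n choose k)
  without truncated subtraction. It bounds the middle term in \<open>binomial_square_le\<close> and
  yields the closed formula for the dimension.\<close>

lemma binomial_two_absorb:
  "(m + d + 2) * (m + d + 1) * (m + d choose m) = (m + 1) * (d + 1) * (m + d + 2 choose (m + 1))"
proof -
  have 1: "(m + d + 2) * (m + d + 1 choose m) = (m + d + 2 choose (m + 1)) * (m + 1)"
    using Suc_times_binomial_eq[of "m + d + 1" m] by (simp only: Suc_eq_plus1 add.assoc one_add_one)
  have 2: "(d + 1) * (m + d + 1 choose m) = (m + d + 1) * (m + d choose m)"
    using binomial_absorb_comp[of "m + d + 1" m] by (simp del: binomial_Suc_Suc)
  have "(m + d + 2) * (m + d + 1) * (m + d choose m) = (m + d + 2) * ((d + 1) * (m + d + 1 choose m))"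
    by (simp only: 2 mult.assoc)
  also have "\<dots> = (d + 1) * ((m + d + 2) * (m + d + 1 choose m))" by (simp only: mult_ac)
  finally show ?thesis unfolding 1 by (simp only: mult_ac)
qed

text \<open>Away from the ends, the left-hand side is at most \<open>(j - 1) / (2 * j - 1)\<close> times
  \<open>(2 * j) choose (2 * i)\<close>, and the right-hand side is at least that.\<close>

lemma binomial_square_le:
  assumes j: "j \<ge> 6" and i: "1 \<le> i" "i \<le> j - 1"
  shows "(j choose i)\<^sup>2 \<le> ((2 * j - 2) choose (2 * i)) + ((2 * j - 2) choose (2 * i - 2))"
proof -
  \<comment> \<open>For \<open>i = 1\<close> and \<open>i = j - 1\<close> the product inequality for
    central binomials fails, so both ends are settled by this quadratic comparison.\<close>
  have edge: "j\<^sup>2 \<le> ((2 * j - 2) choose 2) + 1"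
  proof -
    obtain d where d: "j = d + 6" using j by (metis add.commute le_Suc_ex)
    have "(2 * j - 2) choose 2 = (d + 5) * (2 * d + 9)"
      unfolding choose_two d by (simp add: algebra_simps)
    then show ?thesis by (simp add: d power2_eq_square algebra_simps)
  qed
  consider "i = 1" | "i = j - 1" | "2 \<le> i" "i \<le> j - 2" using i by linarith
  then show ?thesis
  proof cases
    case 1
    then show ?thesis using edge by simp
  next
    case 2
    have "(2 * j - 2) choose (2 * i - 2) = (2 * j - 2) choose 2"
      by (subst binomial_symmetric) (use 2 j in \<open>auto intro!: arg_cong[where f = "(choose) _"]\<close>)
    moreover have "j choose i = j"
      using binomial_symmetric[of 1 j] 2 j by simp
    moreover have "2 * j - 2 = 2 * i" using 2 j by simp
    ultimately show ?thesis using edge by (simp add: add.commute)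
  next
    case 3
    define b where "b = j - i"
    have jb: "j = i + b" and b: "b \<ge> 2" using 3 j by (auto simp: b_def)
    define T where "T = (2 * j) choose (2 * i)"
    have "(2 * j - 1) * (j choose i)\<^sup>2 * ((2 * j) choose j) = T * ((2 * j - 1) * (((2 * i) choose i) * ((2 * b) choose b)))"
      unfolding T_def mult.assoc binomial_square_central[OF jb] by (simp only: mult_ac)
    also have "\<dots> \<le> T * ((j - 1) * ((2 * j) choose j))"
      by (intro mult_left_mono central_binomial_product_le 3 b jb j) auto
    finally have le1: "(2 * j - 1) * (j choose i)\<^sup>2 \<le> (j - 1) * T"
      by (simp add: mult_ac)
    \<comment> \<open>\<open>T\<close> splits by how many of two marked points are chosen,
      \<open>2 * M\<close> counting exactly one. Since 4ib is at most (i + b)^2 = j^2, this part is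
      at most j / (2j - 1) of \<open>T\<close>.\<close>
    define M where "M = (2 * j - 2) choose (2 * i - 1)"
    have split: "T = ((2 * j - 2) choose (2 * i)) + 2 * M + ((2 * j - 2) choose (2 * i - 2))"
      using binomial_pair_split[of "2 * j - 2" "2 * i - 2"] 3 by (simp add: T_def M_def numeral_2_eq_2 Suc_diff_Suc)
    have idx: "2 * i - 1 + (2 * b - 1) = 2 * j - 2" "2 * j - 2 + 2 = 2 * j" "2 * j - 2 + 1 = 2 * j - 1"
      "2 * i - 1 + 1 = 2 * i" "2 * b - 1 + 1 = 2 * b"
      using 3 b jb by auto
    have "2 * j * (2 * j - 1) * M = 2 * i * (2 * b) * T"
      using binomial_two_absorb[of "2 * i - 1" "2 * b - 1"] unfolding idx T_def M_def .
    then have "j * ((2 * j - 1) * (2 * M)) = 4 * (i * b) * T"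
      by (simp add: mult_ac)
    also have "4 * (i * b) \<le> j * j"
    proof -
      have "int (j * j) - int (4 * (i * b)) = (int i - int b)\<^sup>2" by (simp add: jb power2_eq_square algebra_simps)
      then show ?thesis by (metis diff_ge_0_iff_ge of_nat_le_iff zero_le_power2)
    qed
    finally have "(2 * j - 1) * (2 * M) \<le> j * T" using j by simp
    moreover have "(2 * j - 1) * T = (j - 1) * T + j * T"
      using j by (simp add: mult_2 flip: add_mult_distrib)
    ultimately have "(j - 1) * T \<le> (2 * j - 1) * (((2 * j - 2) choose (2 * i)) + ((2 * j - 2) choose (2 * i - 2)))"
      using split by (simp add: add_mult_distrib2)
    with le1 have "(2 * j - 1) * (j choose i)\<^sup>2 \<le> (2 * j - 1) * (((2 * j - 2) choose (2 * i)) + ((2 * j - 2) choose (2 * i - 2)))"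
      by linarith
    then show ?thesis using j by simp
  qed
qed

section \<open>The number of unresolved sets\<close>

text \<open>Counts the \<open>m\<close>-subsets of the union of two disjoint \<open>j\<close>-sets
  that meet both in equally many points; see \<open>card_balanced_subsets\<close>.\<close>

definition balanced :: "nat \<Rightarrow> nat \<Rightarrow> nat" where
  "balanced j m = (if even m then (j choose (m div 2))\<^sup>2 else 0)"

text \<open>Counts the \<open>k\<close>-subsets of an \<open>n\<close>-set that do not resolve a
  given pair at distance \<open>j\<close>; \<open>m\<close> is the number of points in the symmetric
  difference of the pair. See \<open>card_unresolved\<close>.\<close>

definition unresolved :: "nat \<Rightarrow> nat \<Rightarrow> nat \<Rightarrow> nat" where
  "unresolved n k j = (\<Sum>m\<le>k. balanced j m * ((n - 2 * j) choose (k - m)))"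

lemma unresolved_eq_fps_nth:
  "unresolved n k j = fps_nth (Abs_fps (balanced j) * Abs_fps (\<lambda>i. (n - 2 * j) choose i)) k"
  by (simp add: unresolved_def fps_mult_nth atLeast0AtMost)

text \<open>As power series, (1+x)^(n-2j) = (1+x)^(s-2j) (1+x)^(n-s) by Vandermonde, so conditioning
  on the trace in \<open>s\<close> points is associativity of the product.\<close>

lemma unresolved_restrict:
  assumes "2 * j \<le> s" "s \<le> n"
  shows "unresolved n k j = (\<Sum>m\<le>k. unresolved s m j * ((n - s) choose (k - m)))"
proof -
  have "n - 2 * j = (s - 2 * j) + (n - s)" using assms by simp
  then have "Abs_fps (\<lambda>i. (n - 2 * j) choose i) = Abs_fps (\<lambda>i. (s - 2 * j) choose i) * Abs_fps (\<lambda>i. (n - s) choose i)"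
    by (simp add: fps_eq_iff fps_mult_nth atLeast0AtMost vandermonde)
  then have "unresolved n k j = fps_nth (Abs_fps (balanced j) * Abs_fps (\<lambda>i. (s - 2 * j) choose i) * Abs_fps (\<lambda>i. (n - s) choose i)) k"
    by (simp only: unresolved_eq_fps_nth mult.assoc)
  also have "Abs_fps (balanced j) * Abs_fps (\<lambda>i. (s - 2 * j) choose i) = Abs_fps (\<lambda>m. unresolved s m j)"
    by (simp only: fps_eq_iff unresolved_eq_fps_nth fps_nth_Abs_fps simp_thms)
  finally show ?thesis by (simp add: fps_mult_nth atLeast0AtMost)
qed

text \<open>The weights in \<open>unresolved_restrict\<close> do not depend on the distance, so a
  comparison within \<open>s\<close> points for every \<open>m\<close> carries over to
  \<open>n\<close>.\<close>

lemma unresolved_mono: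
  assumes "2 * i \<le> s" "2 * j \<le> s" "s \<le> n" "\<And>m. unresolved s m i \<le> unresolved s m j"
  shows "unresolved n k i \<le> unresolved n k j"
  using assms by (auto simp: unresolved_restrict[of _ s n] intro!: sum_mono)

section \<open>Explicit counts and the comparison with distance 1\<close>

lemma unresolved_double: "unresolved (2 * j) m j = balanced j m"
proof -
  have "unresolved (2 * j) m j = (\<Sum>i\<le>m. if i = m then balanced j i else 0)"
    unfolding unresolved_def by (intro sum.cong) (auto simp: binomial_eq_0)
  then show ?thesis by simp
qed

lemma unresolved_double_Suc:
  "unresolved (2 * j + 1) m j = balanced j m + (if m = 0 then 0 else balanced j (m - 1))"
proof (cases m)
  case (Suc l)
  have "unresolved (2 * j + 1) (Suc l) j = (\<Sum>i\<le>l. balanced j i * (1 choose (Suc l - i))) + balanced j (Suc l)"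
    by (simp add: unresolved_def)
  also have "(\<Sum>i\<le>l. balanced j i * (1 choose (Suc l - i))) = (\<Sum>i\<le>l. if i = l then balanced j i else 0)"
    by (intro sum.cong) (auto simp: binomial_eq_0)
  finally show ?thesis using Suc by simp
qed (simp add: unresolved_def)

text \<open>At distance 1 an unresolved set contains neither or both of the two differing points.
  The guard is needed because \<open>k - 2\<close> would truncate to 0 and contribute 1.\<close>

lemma unresolved_one:
  "unresolved n k 1 = ((n - 2) choose k) + (if k < 2 then 0 else (n - 2) choose (k - 2))"
proof -
  have bal: "balanced 1 m = (if m = 0 then 1 else 0) + (if m = 2 then 1 else 0)" for m
  proof -
    consider "m = 0" | "m = 1" | "m = 2" | "m \<ge> 3" by linarith
    then show ?thesis by cases (auto simp: balanced_def binomial_eq_0)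
  qed
  have "unresolved n k 1 = (\<Sum>m\<le>k. (if m = 0 then (n - 2) choose (k - m) else 0) + (if m = 2 then (n - 2) choose (k - m) else 0))"
    unfolding unresolved_def bal by (intro sum.cong) auto
  then show ?thesis by (auto simp: sum.distrib)
qed

lemma balanced_eq_0: "m > 2 * j \<Longrightarrow> balanced j m = 0"
  by (auto simp: balanced_def binomial_eq_0)

lemma unresolved_double_le:
  assumes "j \<ge> 6"
  shows "unresolved (2 * j) m j \<le> unresolved (2 * j) m 1"
proof -
  consider "odd m" | "m = 0" | i where "m = 2 * i" "i \<ge> 1" "i \<le> j - 1" | "m = 2 * j" | "m > 2 * j"
    by (cases "even m") (auto elim!: evenE, force)
  then show ?thesis
  proof cases
    case (3 i)
    then show ?thesis using binomial_square_le[OF assms, of i]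
      unfolding unresolved_double unresolved_one balanced_def by auto
  next
    case 5
    then show ?thesis by (simp add: unresolved_double balanced_eq_0)
  qed (use assms in \<open>auto simp: unresolved_double unresolved_one[simplified] balanced_def\<close>)
qed

text \<open>With \<open>2 * j\<close> instead of \<open>2 * j + 1\<close> this fails: at \<open>m = 2\<close> for \<open>j = 2, 3\<close>
  and at \<open>m = 4\<close> for \<open>j = 4, 5\<close>.\<close>

lemma unresolved_double_Suc_le:
  assumes "2 \<le> j" "j \<le> 5"
  shows "unresolved (2 * j + 1) m j \<le> unresolved (2 * j + 1) m 1"
\<comment> \<open>As \<open>2 * j \<le> 10\<close>, both \<open>m\<close> and \<open>m - 1\<close>
  exceed \<open>2 * j\<close> once \<open>m > 11\<close>, and the left-hand side vanishes; the rest
  is a finite check.\<close>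
proof (cases "m \<le> 11")
  case True
  then have "m = 0 \<or> m = 1 \<or> m = 2 \<or> m = 3 \<or> m = 4 \<or> m = 5 \<or> m = 6 \<or> m = 7 \<or> m = 8 \<or> m = 9 \<or> m = 10 \<or> m = 11"
    by presburger
  moreover have "j = 2 \<or> j = 3 \<or> j = 4 \<or> j = 5" using assms by linarith
  ultimately show ?thesis unfolding unresolved_double_Suc unresolved_one
    by (elim disjE; simp add: balanced_def binomial_fact' fact_numeral binomial_eq_0)
next
  case False
  then show ?thesis unfolding unresolved_double_Suc using assms by (simp add: balanced_eq_0)
qed

lemma unresolved_le_unresolved_one:
  assumes "1 \<le> j" "j \<le> k" "2 * k \<le> n" "(n, k) \<noteq> (4, 2)" "(n, k) \<noteq> (8, 4)"
  shows "unresolved n k j \<le> unresolved n k 1"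
proof -
  consider "j = 1" | "j \<ge> 6" | "2 \<le> j" "j \<le> 5" "n = 2 * j" | "2 \<le> j" "j \<le> 5" "n \<ge> 2 * j + 1"
    using assms by linarith
  then show ?thesis
  proof cases
    case 2
    show ?thesis
      by (rule unresolved_mono[where s = "2 * j"], use 2 assms in linarith, use 2 in linarith,
          use assms in linarith, rule unresolved_double_le[OF 2])
  next
    case 3
    then have k: "k = j" using assms by linarith
    have "j = 2 \<or> j = 3 \<or> j = 4 \<or> j = 5" using 3 by presburger
    then have "odd k" using assms(4,5) 3 k by auto
    with k show ?thesis unfolding 3(3) by (simp add: unresolved_double balanced_def)
  next
    case 4
    show ?thesis
      by (rule unresolved_mono[where s = "2 * j + 1"], use 4 in linarith, use 4 in linarith,
          use 4 in linarith, rule unresolved_double_Suc_le[OF 4(1,2)])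
  qed simp
qed

lemma atMost_4: "{..4::nat} = {0, 1, 2, 3, 4}" and atMost_2: "{..2::nat} = {0, 1, 2}"
  by auto

text \<open>In both exceptional cases the maximum is attained by complementary pairs,
  \<open>j = k\<close>, and the dimensions become 6 / (6 - 4) and 70 / (70 - 36).\<close>

lemma unresolved_4_2:
  "unresolved 4 2 1 = 2" "unresolved 4 2 2 = 4"
  by (simp_all add: unresolved_def balanced_def atMost_2 binomial_fact' fact_numeral binomial_eq_0)

lemma unresolved_8_4:
  "unresolved 8 4 1 = 30" "unresolved 8 4 2 = 26" "unresolved 8 4 3 = 18" "unresolved 8 4 4 = 36"
  by (simp_all add: unresolved_def balanced_def atMost_4 binomial_fact' fact_numeral binomial_eq_0)

section \<open>Counting sets by their traces on disjoint pieces\<close>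

lemma card_subsets_disjoint_Un:
  assumes "A \<inter> B = {}" "\<A> \<subseteq> Pow A" "\<B> \<subseteq> Pow B"
  shows "card {z. z \<subseteq> A \<union> B \<and> z \<inter> A \<in> \<A> \<and> z \<inter> B \<in> \<B>} = card \<A> * card \<B>"
proof -
  have "bij_betw (\<lambda>z. (z \<inter> A, z \<inter> B)) {z. z \<subseteq> A \<union> B \<and> z \<inter> A \<in> \<A> \<and> z \<inter> B \<in> \<B>} (\<A> \<times> \<B>)"
  proof (rule bij_betw_byWitness[where f' = "\<lambda>(a, b). a \<union> b"])
    have *: "(a \<union> b) \<inter> A = a" "(a \<union> b) \<inter> B = b" if "a \<in> \<A>" "b \<in> \<B>" for a b
      using that assms by blast+
    show "\<forall>p\<in>\<A> \<times> \<B>. ((case p of (a, b) \<Rightarrow> a \<union> b) \<inter> A, (case p of (a, b) \<Rightarrow> a \<union> b) \<inter> B) = p"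
      using * by auto
    show "(\<lambda>(a, b). a \<union> b) ` (\<A> \<times> \<B>) \<subseteq> {z. z \<subseteq> A \<union> B \<and> z \<inter> A \<in> \<A> \<and> z \<inter> B \<in> \<B>}"
      using * assms by auto
  qed auto
  then show ?thesis
    by (simp add: bij_betw_same_card card_cartesian_product)
qed

lemma card_balanced_subsets:
  assumes "finite P" "finite Q" "P \<inter> Q = {}" "card P = j" "card Q = j"
  shows "card {w. w \<subseteq> P \<union> Q \<and> card w = m \<and> card (w \<inter> P) = card (w \<inter> Q)} = balanced j m"
proof -
  have card_w: "card w = card (w \<inter> P) + card (w \<inter> Q)" if "w \<subseteq> P \<union> Q" for w
  proof -
    have "w = (w \<inter> P) \<union> (w \<inter> Q)" using that by blast
    then show ?thesis
      using assms by (metis card_Un_disjoint disjoint_iff finite_Int IntD2)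
  qed
  show ?thesis
  proof (cases "even m")
    case True
    then obtain i where m: "m = 2 * i" by (auto elim: evenE)
    have "{w. w \<subseteq> P \<union> Q \<and> card w = m \<and> card (w \<inter> P) = card (w \<inter> Q)} =
      {w. w \<subseteq> P \<union> Q \<and> w \<inter> P \<in> {a. a \<subseteq> P \<and> card a = i} \<and> w \<inter> Q \<in> {b. b \<subseteq> Q \<and> card b = i}}"
      using card_w m by auto
    also have "card \<dots> = (j choose i) * (j choose i)"
      by (subst card_subsets_disjoint_Un) (use assms in \<open>auto simp: n_subsets\<close>)
    finally show ?thesis by (simp add: balanced_def m power2_eq_square)
  next
    case False
    then have "{w. w \<subseteq> P \<union> Q \<and> card w = m \<and> card (w \<inter> P) = card (w \<inter> Q)} = {}"
      using card_w by auto
    then show ?thesis using False by (simp only: balanced_def card.empty if_False)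
  qed
qed

text \<open>The points of \<open>z\<close> in \<open>A \<inter> B\<close> count equally for both
  sides and cancel, so only the traces of \<open>z\<close> on \<open>A - B\<close> and
  \<open>B - A\<close> decide.\<close>

lemma card_unresolved:
  assumes fin: "finite X" and sub: "A \<subseteq> X" "B \<subseteq> X" and card: "card A = k" "card B = k"
  shows "card {z. z \<subseteq> X \<and> card z = l \<and> card (A \<inter> z) = card (B \<inter> z)} = unresolved (card X) l (card (A - B))"
proof -
  define P Q S R where "P = A - B" and "Q = B - A" and "S = P \<union> Q" and "R = X - S"
  have finAB: "finite A" "finite B" using fin sub finite_subset by auto
  then have fins: "finite P" "finite Q" "finite S" "finite R" using fin by (auto simp: P_def Q_def S_def R_def)
  have PQ: "P \<inter> Q = {}" by (auto simp: P_def Q_def)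
  have X: "X = S \<union> R" and SR: "S \<inter> R = {}" using sub by (auto simp: P_def Q_def S_def R_def)
  have cPQ: "card Q = card P"
    using finAB card by (simp add: P_def Q_def card_Diff_subset_Int Int_commute)
  have cR: "card R = card X - 2 * card P"
  proof -
    have "card S = 2 * card P" using fins PQ cPQ by (simp add: S_def card_Un_disjoint)
    moreover have "S \<subseteq> X" using X by blast
    ultimately show ?thesis using fins by (simp add: R_def card_Diff_subset)
  qed
  have bal: "card (A \<inter> z) = card (B \<inter> z) \<longleftrightarrow> card (z \<inter> P) = card (z \<inter> Q)" for z
  proof -
    have "A \<inter> z = (z \<inter> P) \<union> (A \<inter> B \<inter> z)" "B \<inter> z = (z \<inter> Q) \<union> (A \<inter> B \<inter> z)"
      by (auto simp: P_def Q_def)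
    moreover have "(z \<inter> P) \<inter> (A \<inter> B \<inter> z) = {}" "(z \<inter> Q) \<inter> (A \<inter> B \<inter> z) = {}"
      by (auto simp: P_def Q_def)
    ultimately have "card (A \<inter> z) = card (z \<inter> P) + card (A \<inter> B \<inter> z)"
      "card (B \<inter> z) = card (z \<inter> Q) + card (A \<inter> B \<inter> z)"
      using fins finAB by (metis card_Un_disjoint finite_Int)+
    then show ?thesis by simp
  qed
  have card_z: "card z = card (z \<inter> S) + card (z \<inter> R)" if "z \<subseteq> X" for z
  proof -
    have "z = (z \<inter> S) \<union> (z \<inter> R)" "(z \<inter> S) \<inter> (z \<inter> R) = {}" using that X SR by auto
    then show ?thesis using fins by (metis card_Un_disjoint finite_Int)
  qed
  \<comment> \<open>The unresolved sets are classified by \<open>m = card (z \<inter> S)\<close>;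
    within a class the traces on \<open>S\<close> and \<open>R\<close> are independent.\<close>
  define F where "F m = {z. z \<subseteq> S \<union> R \<and> z \<inter> S \<in> {w. w \<subseteq> S \<and> card w = m \<and> card (w \<inter> P) = card (w \<inter> Q)} \<and>
    z \<inter> R \<in> {c. c \<subseteq> R \<and> card c = l - m}}" for m
  have cF: "card (F m) = balanced (card P) m * ((card X - 2 * card P) choose (l - m))" for m
    unfolding F_def
    by (subst card_subsets_disjoint_Un)
      (use SR fins card_balanced_subsets[OF fins(1,2) PQ refl cPQ, of m] in \<open>auto simp: n_subsets cR S_def\<close>)
  have inner: "z \<inter> S \<inter> P = z \<inter> P" "z \<inter> S \<inter> Q = z \<inter> Q" for z by (auto simp: S_def)
  have "{z. z \<subseteq> X \<and> card z = l \<and> card (A \<inter> z) = card (B \<inter> z)} = (\<Union>m\<le>l. F m)"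
    using card_z by (auto simp: F_def bal inner X)
  moreover have "finite (F m)" for m
    using fins by (intro finite_subset[of "F m" "Pow (S \<union> R)"]) (auto simp: F_def)
  then have "card (\<Union>m\<le>l. F m) = (\<Sum>m\<le>l. card (F m))"
    by (intro card_UN_disjoint) (auto simp: F_def)
  ultimately show ?thesis
    by (simp add: cF unresolved_def P_def)
qed

section \<open>Distances and resolving sets in the Johnson graph\<close>

text \<open>An arc from \<open>A\<close> to \<open>A'\<close> loses exactly one point of
  \<open>A\<close>, and \<open>A - B\<close> lies in \<open>(A - A') \<union> (A' - B)\<close>, so
  each arc lowers the difference by at most one.\<close>

lemma card_Diff_le_awalk_length:
  assumes fin: "finite X"
    and "pre_digraph.awalk (with_proj (johnson_graph X k)) A p B"
  shows "card (A - B) \<le> length p"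
proof -
  interpret pair_graph "johnson_graph X k" using fin by (rule pair_graph_johnson_graph)
  show ?thesis using assms(2)
  proof (induction p arbitrary: A)
    case Nil
    then show ?case by (simp add: awalk_Nil_iff)
  next
    case (Cons e p)
    obtain A' where e: "e = (A, A')" and arc: "(A, A') \<in> parcs (johnson_graph X k)" and p: "awalk A' p B"
      using Cons.prems by (cases e) (auto simp: awalk_Cons_iff)
    from arc have A: "A \<subseteq> X" "card A = k" "A' \<subseteq> X" "card (A \<inter> A') + 1 = k"
      by (auto simp: parcs_johnson_graph pverts_johnson_graph)
    then have finA: "finite A" "finite A'" using fin finite_subset by auto
    then have "card (A - A') = 1" using A by (simp add: card_Diff_subset_Int)
    moreover have "card (A - B) \<le> card ((A - A') \<union> (A' - B))"
      using finA by (intro card_mono) auto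
    moreover have "\<dots> \<le> card (A - A') + card (A' - B)" by (rule card_Un_le)
    ultimately show ?case using Cons.IH[OF p] by simp
  qed
qed

text \<open>Exchanging a point of \<open>A - B\<close> for one of \<open>B - A\<close> is an arc
  that lowers \<open>card (A - B)\<close> by one.\<close>

lemma ex_awalk_length_card_Diff:
  assumes fin: "finite X" and "A \<in> pverts (johnson_graph X k)" "B \<in> pverts (johnson_graph X k)"
  shows "\<exists>p. pre_digraph.awalk (with_proj (johnson_graph X k)) A p B \<and> length p = card (A - B)"
proof -
  interpret pair_graph "johnson_graph X k" using fin by (rule pair_graph_johnson_graph)
  show ?thesis using assms(2,3)
  proof (induction "card (A - B)" arbitrary: A)
    case 0
    then have sub: "A \<subseteq> X" "card A = k" "B \<subseteq> X" "card B = k" by (auto simp: pverts_johnson_graph)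
    then have finA: "finite A" "finite B" using fin finite_subset by auto
    then have "A = B" using 0 sub by (metis Diff_eq_empty_iff card_0_eq card_subset_eq finite_Diff)
    then have "awalk A [] B" using 0 by (simp add: awalk_Nil_iff)
    then show ?case using \<open>A = B\<close> by (intro exI[of _ "[]"]) simp
  next
    case (Suc d)
    then have sub: "A \<subseteq> X" "card A = k" "B \<subseteq> X" "card B = k" by (auto simp: pverts_johnson_graph)
    then have finA: "finite A" "finite B" using fin finite_subset by auto
    obtain a where a: "a \<in> A" "a \<notin> B" using Suc(2) by (metis Diff_iff card_gt_0_iff all_not_in_conv zero_less_Suc)
    have "\<not> B \<subseteq> A" using a sub finA by (metis card_subset_eq)
    then obtain b where b: "b \<in> B" "b \<notin> A" by auto
    define A' where "A' = insert b (A - {a})"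
    have "card A > 0" using a finA by (auto simp: card_gt_0_iff)
    then have "card A' = k" using a b finA sub by (simp add: A'_def)
    then have A': "A' \<in> pverts (johnson_graph X k)" using sub b by (auto simp: pverts_johnson_graph A'_def)
    have "A \<inter> A' = A - {a}" using b by (auto simp: A'_def)
    then have "card (A \<inter> A') + 1 = k" using \<open>card A > 0\<close> a finA sub by simp
    then have arc: "(A, A') \<in> parcs (johnson_graph X k)"
      using Suc.prems A' by (simp only: parcs_johnson_graph simp_thms)
    have "A' - B = (A - B) - {a}" using b by (auto simp: A'_def)
    then have "d = card (A' - B)" using Suc(2) a finA by simp
    from Suc(1)[OF this A' Suc.prems(2)] obtain p where "awalk A' p B" "length p = card (A' - B)" by auto
    then have "awalk A ((A, A') # p) B \<and> length ((A, A') # p) = card (A - B)"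
      using arc Suc.prems \<open>d = card (A' - B)\<close> Suc(2) by (simp add: awalk_Cons_iff)
    then show ?case by blast
  qed
qed

lemma graph_dist_johnson_graph:
  assumes fin: "finite X" and "A \<in> pverts (johnson_graph X k)" "B \<in> pverts (johnson_graph X k)"
  shows "graph_dist (with_proj (johnson_graph X k)) A B = ereal (card (A - B))"
proof -
  interpret pair_graph "johnson_graph X k" using fin by (rule pair_graph_johnson_graph)
  have cost: "awalk_cost (\<lambda>_. 1) p = length p" for p
    by (induction p) auto
  obtain p where p: "awalk A p B" "length p = card (A - B)"
    using ex_awalk_length_card_Diff[OF assms] by blast
  show ?thesis unfolding graph_dist_def
  proof (rule antisym)
    show "\<mu> (\<lambda>_. 1) A B \<le> ereal (card (A - B))"
      using min_cost_le_walk_cost[OF p(1), of "\<lambda>_. 1"] p(2) by (simp add: cost)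
    show "ereal (card (A - B)) \<le> \<mu> (\<lambda>_. 1) A B"
      unfolding \<mu>_def using card_Diff_le_awalk_length[OF fin] by (intro INF_greatest) (auto simp: cost)
  qed
qed

lemma resolving_set_johnson_graph:
  assumes fin: "finite X" and "A \<in> pverts (johnson_graph X k)" "B \<in> pverts (johnson_graph X k)"
  shows "resolving_set (with_proj (johnson_graph X k)) A B =
    {z \<in> pverts (johnson_graph X k). card (A \<inter> z) \<noteq> card (B \<inter> z)}"
proof -
  \<comment> \<open>The bound by \<open>k\<close> makes the truncated subtraction reversible, so
    equal distances mean equal intersection sizes.\<close>
  have "card (A - z) = k - card (A \<inter> z) \<and> card (A \<inter> z) \<le> k" if "A \<in> pverts (johnson_graph X k)" for A z
  proof -
    have "finite A" "card A = k" using that fin finite_subset by (auto simp: pverts_johnson_graph)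
    then show ?thesis by (metis card_Diff_subset_Int card_mono finite_Int inf_le1)
  qed
  then have "card (A - z) = card (B - z) \<longleftrightarrow> card (A \<inter> z) = card (B \<inter> z)" for z
    using assms(2,3) by (metis diff_diff_cancel)
  then have "graph_dist (with_proj (johnson_graph X k)) A z \<noteq> graph_dist (with_proj (johnson_graph X k)) B z \<longleftrightarrow>
      card (A \<inter> z) \<noteq> card (B \<inter> z)" if "z \<in> pverts (johnson_graph X k)" for z
    using assms(2,3) that by (simp only: graph_dist_johnson_graph[OF fin] ereal.inject of_nat_eq_iff)
  then show ?thesis
    unfolding resolving_set_def with_proj_simps by blast
qed

lemma card_resolving_set:
  assumes fin: "finite X" and AB: "A \<in> pverts (johnson_graph X k)" "B \<in> pverts (johnson_graph X k)"
  shows "card (resolving_set (with_proj (johnson_graph X k)) A B) =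
    (card X choose k) - unresolved (card X) k (card (A - B))"
proof -
  have "card (resolving_set (with_proj (johnson_graph X k)) A B) =
    card ({z. z \<subseteq> X \<and> card z = k} - {z. z \<subseteq> X \<and> card z = k \<and> card (A \<inter> z) = card (B \<inter> z)})"
    unfolding resolving_set_johnson_graph[OF assms]
    by (intro arg_cong[where f = card]) (auto simp: pverts_johnson_graph)
  also have "\<dots> = card {z. z \<subseteq> X \<and> card z = k} - card {z. z \<subseteq> X \<and> card z = k \<and> card (A \<inter> z) = card (B \<inter> z)}"
    using fin by (intro card_Diff_subset) (auto intro: finite_subset[of _ "Pow X"])
  finally show ?thesis
    using card_unresolved[OF fin, of A B k k] AB fin by (simp add: n_subsets pverts_johnson_graph)
qed

section \<open>The fractional metric dimension\<close>

lemma ex_bij_betw_image: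
  assumes "finite X" "z \<subseteq> X" "z' \<subseteq> X" "card z = card z'"
  obtains h where "bij_betw h X X" "h ` z = z'"
proof -
  have fin: "finite z" "finite z'" using assms finite_subset by auto
  obtain f where f: "bij_betw f z z'" using assms fin finite_same_card_bij by blast
  have "card (X - z) = card (X - z')" using assms fin by (simp add: card_Diff_subset)
  then obtain g where g: "bij_betw g (X - z) (X - z')" using assms finite_same_card_bij by (metis finite_Diff)
  define h where "h x = (if x \<in> z then f x else g x)" for x
  have hf: "bij_betw h z z'" using f by (subst bij_betw_cong[of z h f]) (auto simp: h_def)
  have hg: "bij_betw h (X - z) (X - z')" using g by (subst bij_betw_cong[of _ h g]) (auto simp: h_def)
  have "bij_betw h (z \<union> (X - z)) (z' \<union> (X - z'))"
    using hf hg by (rule bij_betw_combine) auto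
  moreover have "z \<union> (X - z) = X" "z' \<union> (X - z') = X" using assms by auto
  ultimately show ?thesis using that[of h] hf by (simp add: bij_betw_def)
qed

text \<open>A permutation of \<open>X\<close> that carries \<open>z\<close> to \<open>z'\<close>
  maps the pairs resolved by \<open>z\<close> injectively to pairs resolved by \<open>z'\<close>.
  Exchanging \<open>z\<close> and \<open>z'\<close> gives equality.\<close>

lemma card_resolved_pairs_le:
  assumes fin: "finite X" and z: "z \<subseteq> X" "z' \<subseteq> X" "card z = card z'"
  shows "card {(A, B). A \<subseteq> X \<and> card A = k \<and> B \<subseteq> X \<and> card B = k \<and> card (A - B) = j \<and>
      card (A \<inter> z) \<noteq> card (B \<inter> z)} \<le>
    card {(A, B). A \<subseteq> X \<and> card A = k \<and> B \<subseteq> X \<and> card B = k \<and> card (A - B) = j \<and>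
      card (A \<inter> z') \<noteq> card (B \<inter> z')}"
    (is "card ?L \<le> card ?R")
proof -
  obtain h where h: "bij_betw h X X" "h ` z = z'" using ex_bij_betw_image[OF assms] .
  then have inj: "inj_on h X" and im: "h ` X = X" by (auto simp: bij_betw_def)
  have card_h: "card (h ` A) = card A" if "A \<subseteq> X" for A
    using inj that by (meson card_image inj_on_subset)
  have "(h ` A, h ` B) \<in> ?R" if "(A, B) \<in> ?L" for A B
  proof -
    have AB: "A \<subseteq> X" "B \<subseteq> X" using that by auto
    have "h ` A - h ` B = h ` (A - B)"
      using inj AB by (metis Diff_subset inj_on_image_set_diff subset_trans)
    moreover have "h ` A \<inter> z' = h ` (A \<inter> z)" "h ` B \<inter> z' = h ` (B \<inter> z)"
      using inj AB z h(2) by (metis inj_on_image_Int)+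
    moreover have "A - B \<subseteq> X" "A \<inter> z \<subseteq> X" "B \<inter> z \<subseteq> X" using AB by auto
    moreover have "h ` A \<subseteq> X" "h ` B \<subseteq> X" using AB im by blast+
    ultimately show ?thesis using that AB by (simp add: card_h)
  qed
  then have "(\<lambda>(A, B). (h ` A, h ` B)) ` ?L \<subseteq> ?R" by force
  moreover have "inj_on (\<lambda>(A, B). (h ` A, h ` B)) ?L"
    using inj by (auto simp: inj_on_def inj_on_image_eq_iff[OF inj])
  moreover have "finite ?R"
    using fin by (intro finite_subset[of ?R "Pow X \<times> Pow X"]) auto
  ultimately show ?thesis by (intro card_inj_on_le)
qed

lemma frac_metric_dim_johnson_graph:
  assumes fin: "finite X" and n: "card X = n" and k: "2 * k \<le> n"
    and i: "1 \<le> i" "i \<le> k"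
    and max: "\<And>j. 1 \<le> j \<Longrightarrow> j \<le> k \<Longrightarrow> unresolved n k j \<le> unresolved n k i"
  shows "frac_metric_dim (with_proj (johnson_graph X k)) =
    real (n choose k) / real ((n choose k) - unresolved n k i)"
proof -
  let ?G = "with_proj (johnson_graph X k)"
  define V where "V = pverts (johnson_graph X k)"
  have V: "A \<in> V \<longleftrightarrow> A \<subseteq> X \<and> card A = k" for A unfolding V_def by (rule pverts_johnson_graph)
  have finV: "finite V" using fin by (intro finite_subset[of V "Pow X"]) (auto simp: V)
  have cardV: "card V = n choose k"
    using n_subsets[OF fin, of k] n by (simp add: V_def johnson_graph_def)
  define r where "r = (n choose k) - unresolved n k i"
  have res: "resolving_set ?G A B = {z \<in> V. card (A \<inter> z) \<noteq> card (B \<inter> z)}" if "A \<in> V" "B \<in> V" for A B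
    using resolving_set_johnson_graph[OF fin] that by (simp add: V_def)
  have card_res: "card (resolving_set ?G A B) = (n choose k) - unresolved n k (card (A - B))" if "A \<in> V" "B \<in> V" for A B
    using card_resolving_set[OF fin] that n by (simp add: V_def)
  \<comment> \<open>A pair at distance exactly \<open>i\<close> is built inside a set of
    \<open>k + i\<close> points. It shows that \<open>r\<close> is positive and that the averaged
    family \<open>T\<close> is nonempty.\<close>
  have "k + i \<le> card X" using k i n by simp
  then obtain Y where Y: "Y \<subseteq> X" "card Y = k + i" using obtain_subset_with_card_n by metis
  then have finY: "finite Y" using fin finite_subset by auto
  obtain A0 where A0: "A0 \<subseteq> Y" "card A0 = k" using obtain_subset_with_card_n[of k Y] Y by auto
  have finA0: "finite A0" using finY A0 finite_subset by auto
  obtain C where C: "C \<subseteq> A0" "card C = i" using obtain_subset_with_card_n[of i A0] A0 i by auto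
  define B0 where "B0 = Y - C"
  have finC: "finite C" using C finA0 finite_subset by auto
  have "card B0 = k" unfolding B0_def using C A0 Y finC by (subst card_Diff_subset) auto
  then have AB0: "A0 \<in> V" "B0 \<in> V" using A0 Y by (auto simp: V B0_def)
  have "A0 - B0 = C" using A0 C by (auto simp: B0_def)
  then have cAB0: "card (A0 - B0) = i" using C by simp
  have rpos: "r > 0"
  proof -
    have "card (A0 \<inter> B0) = k - i"
      using cAB0 A0 finA0 i by (metis card_Diff_subset_Int card_mono diff_diff_cancel finite_Int inf_le1)
    then have "A0 \<in> resolving_set ?G A0 B0" using AB0 i A0 by (simp add: res Int_commute)
    moreover have "finite (resolving_set ?G A0 B0)" using AB0 finV by (simp add: res)
    ultimately have "card (resolving_set ?G A0 B0) > 0" by (auto simp: card_gt_0_iff)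
    then show ?thesis using card_res[OF AB0] by (simp add: cAB0 r_def)
  qed
  have feasible: "resolving_function ?G (\<lambda>_. 1 / real r)"
    unfolding resolving_function_def
  proof (intro conjI ballI impI)
    fix A B assume "A \<in> verts ?G" "B \<in> verts ?G" and ne: "A \<noteq> B"
    then have AB: "A \<in> V" "B \<in> V" by (simp_all add: V_def)
    then have finAB: "finite A" "finite B" "card A = k" "card B = k" using fin finite_subset by (auto simp: V)
    have "A - B \<noteq> {}" using ne finAB by (metis Diff_eq_empty_iff card_subset_eq)
    then have "card (A - B) \<ge> 1" using finAB by (simp add: Suc_le_eq card_gt_0_iff)
    moreover have "card (A - B) \<le> k" using finAB by (metis Diff_subset card_mono)
    ultimately have "r \<le> card (resolving_set ?G A B)"
      using max[of "card (A - B)"] by (simp add: card_res[OF AB] r_def diff_le_mono2)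
    then show "1 \<le> (\<Sum>z\<in>resolving_set ?G A B. 1 / real r)"
      using rpos by simp
  qed (use rpos in auto)
  have lower: "real (n choose k) / real r \<le> (\<Sum>v\<in>verts ?G. f v)" if f: "resolving_function ?G f" for f
  proof -
    define T where "T = {(A, B). A \<in> V \<and> B \<in> V \<and> card (A - B) = i}"
    have finT: "finite T" using finV by (intro finite_subset[of T "V \<times> V"]) (auto simp: T_def)
    \<comment> \<open>The number of pairs at distance \<open>i\<close> that \<open>z\<close>
      resolves; by symmetry it is the same for all vertices.\<close>
    define M where "M z = card {p \<in> T. card (fst p \<inter> z) \<noteq> card (snd p \<inter> z)}" for z
    have M_eq: "M z = card {(A, B). A \<subseteq> X \<and> card A = k \<and> B \<subseteq> X \<and> card B = k \<and> card (A - B) = i \<and>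
      card (A \<inter> z) \<noteq> card (B \<inter> z)}" for z
      unfolding M_def by (intro arg_cong[where f = card]) (auto simp: T_def V)
    have M: "M z = M A0" if "z \<in> V" for z
      using that AB0 card_resolved_pairs_le[OF fin] by (intro antisym) (simp_all add: M_eq V)
    \<comment> \<open>Double counting with an arbitrary weight: the weight 1 gives the exact
      relation \<open>count\<close>, the weight \<open>f\<close> gives the inequality
      \<open>le\<close>, and eliminating \<open>card T\<close> between them bounds the total of
      \<open>f\<close>.\<close>
    have swap: "(\<Sum>p\<in>T. \<Sum>z\<in>{z \<in> V. card (fst p \<inter> z) \<noteq> card (snd p \<inter> z)}. g z) = real (M A0) * (\<Sum>z\<in>V. g z)"
      for g :: "'a set \<Rightarrow> real"
    proof -
      have "(\<Sum>p\<in>T. \<Sum>z\<in>{z \<in> V. card (fst p \<inter> z) \<noteq> card (snd p \<inter> z)}. g z) =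
        (\<Sum>z\<in>V. \<Sum>p\<in>{p \<in> T. card (fst p \<inter> z) \<noteq> card (snd p \<inter> z)}. g z)"
        using finT finV by (rule sum.swap_restrict)
      also have "\<dots> = (\<Sum>z\<in>V. real (M A0) * g z)"
        using M by (intro sum.cong) (auto simp: M_def)
      finally show ?thesis by (simp add: sum_distrib_left)
    qed
    have resT: "{z \<in> V. card (fst p \<inter> z) \<noteq> card (snd p \<inter> z)} = resolving_set ?G (fst p) (snd p)" if "p \<in> T" for p
      using that by (auto simp: T_def res)
    have "real (card T) * real r = (\<Sum>p\<in>T. \<Sum>z\<in>{z \<in> V. card (fst p \<inter> z) \<noteq> card (snd p \<inter> z)}. 1)"
      by (subst sum.cong[OF refl, of T _ "\<lambda>_. real r"]) (auto simp: resT, auto simp: T_def card_res r_def)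
    also have "\<dots> = real (M A0) * real (n choose k)"
      by (subst swap) (simp add: cardV)
    finally have count: "real (card T) * real r = real (M A0) * real (n choose k)" .
    have "real (card T) = (\<Sum>p\<in>T. 1)" by simp
    also have "\<dots> \<le> (\<Sum>p\<in>T. \<Sum>z\<in>{z \<in> V. card (fst p \<inter> z) \<noteq> card (snd p \<inter> z)}. f z)"
    proof (rule sum_mono)
      fix p assume p: "p \<in> T"
      then have "fst p \<noteq> snd p" using i by (auto simp: T_def)
      then show "1 \<le> (\<Sum>z\<in>{z \<in> V. card (fst p \<inter> z) \<noteq> card (snd p \<inter> z)}. f z)"
        using f p unfolding resT[OF p] by (cases p) (simp add: resolving_function_def T_def V_def)
    qed
    also have "\<dots> = real (M A0) * (\<Sum>z\<in>V. f z)" by (rule swap)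
    finally have le: "real (card T) \<le> real (M A0) * (\<Sum>z\<in>V. f z)" .
    have "(A0, B0) \<in> T" using AB0 cAB0 by (simp add: T_def)
    then have "card T > 0" using finT by (auto simp: card_gt_0_iff)
    then have "real (M A0) * real (n choose k) > 0" using rpos by (simp flip: count)
    then have Mpos: "real (M A0) > 0" by (simp add: zero_less_mult_iff)
    have "real (M A0) * real (n choose k) \<le> real (M A0) * ((\<Sum>z\<in>V. f z) * real r)"
      using mult_right_mono[OF le, of "real r"] count by (simp add: mult_ac)
    then have "real (n choose k) \<le> (\<Sum>z\<in>V. f z) * real r" using Mpos by simp
    then show ?thesis using rpos by (simp add: V_def divide_simps)
  qed
  show ?thesis unfolding frac_metric_dim_def r_def[symmetric]
  proof (rule Least_equality)
    show "\<exists>f. resolving_function ?G f \<and> real (n choose k) / real r = (\<Sum>v\<in>verts ?G. f v)"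
      using feasible cardV by (intro exI[of _ "\<lambda>_. 1 / real r"]) (simp add: V_def)
  qed (use lower in auto)
qed

section \<open>The exceptional values and the closed formula\<close>

lemma frac_metric_dim_johnson_graph_4_2:
  assumes "finite X" and "card X = 4"
  shows "frac_metric_dim (with_proj (johnson_graph X 2)) = 3"
proof -
  have "(4::nat) choose 2 = 6" by (simp add: binomial_fact' fact_numeral)
  moreover have "unresolved 4 2 j \<le> unresolved 4 2 2" if "1 \<le> j" "j \<le> 2" for j
  proof -
    have "j = 1 \<or> j = 2" using that by linarith
    then show ?thesis by (auto simp: unresolved_4_2 simp del: One_nat_def)
  qed
  ultimately show ?thesis
    using frac_metric_dim_johnson_graph[OF assms, of 2 2] by (simp add: unresolved_4_2)
qed

lemma frac_metric_dim_johnson_graph_8_4: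
  assumes "finite X" and "card X = 8"
  shows "frac_metric_dim (with_proj (johnson_graph X 4)) = 35 / 17"
proof -
  have "(8::nat) choose 4 = 70" by (simp add: binomial_fact' fact_numeral)
  moreover have "unresolved 8 4 j \<le> unresolved 8 4 4" if "1 \<le> j" "j \<le> 4" for j
  proof -
    have "j = 1 \<or> j = 2 \<or> j = 3 \<or> j = 4" using that by linarith
    then show ?thesis by (auto simp: unresolved_8_4 simp del: One_nat_def)
  qed
  ultimately show ?thesis
    using frac_metric_dim_johnson_graph[OF assms, of 4 4] by (simp add: unresolved_8_4)
qed

lemma frac_metric_dim_johnson_graph_generic:
  assumes "finite X" and "card X = n" and "2 \<le> k" and "2 * k \<le> n"
    and "(n, k) \<noteq> (4, 2)" and "(n, k) \<noteq> (8, 4)"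
  shows "frac_metric_dim (with_proj (johnson_graph X k)) =
    ((real n)\<^sup>2 - real n) / (2 * real k * real n - 2 * (real k)\<^sup>2)"
proof -
  define m d where "m = k - 1" and "d = n - k - 1"
  have k: "k = m + 1" and n: "n = m + d + 2" and m: "m \<ge> 1" using assms(3,4) by (auto simp: m_def d_def)
  define c where "c = m + d choose m"
  \<comment> \<open>At distance 1 the resolving sets are those that contain exactly one of two
    points, which is the middle term of \<open>binomial_pair_split\<close>.\<close>
  have "(n choose k) - unresolved n k 1 = 2 * c"
    using binomial_pair_split[of "m + d" "m - 1"] m
    by (simp add: unresolved_one[simplified] c_def n k del: binomial_Suc_Suc)
  then have dim: "frac_metric_dim (with_proj (johnson_graph X k)) = real (n choose k) / (2 * real c)"
    using frac_metric_dim_johnson_graph[OF assms(1,2,4), of 1] unresolved_le_unresolved_one assms by simp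
  have "real ((m + d + 2) * (m + d + 1) * c) = real ((m + 1) * (d + 1) * (n choose k))"
    unfolding c_def n k by (simp only: binomial_two_absorb)
  then have "real n * (real n - 1) * real c = real k * (real n - real k) * real (n choose k)"
    by (simp add: n k algebra_simps del: binomial_Suc_Suc)
  moreover have "c > 0" by (simp add: c_def)
  moreover have "real n > real k" "real k > 0" using assms by auto
  ultimately have "real (n choose k) / (2 * real c) = (real n * (real n - 1)) / (2 * (real k * (real n - real k)))"
    by (simp add: divide_simps)
  also have "\<dots> = ((real n)\<^sup>2 - real n) / (2 * real k * real n - 2 * (real k)\<^sup>2)"
    by (simp add: power2_eq_square algebra_simps)
  finally show ?thesis using dim by simp
qed

theorem theorem2p7:
  fixes X :: "'a set" and n k :: nat
  assumes "finite X" and "card X = n"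
    and "4 \<le> 2 * k" and "2 * k \<le> n"
  shows "frac_metric_dim (with_proj (johnson_graph X k)) =
    (if (n, k) = (4, 2) then 3
     else if (n, k) = (8, 4) then 35 / 17
     else ((real n)\<^sup>2 - real n) / (2 * real k * real n - 2 * (real k)\<^sup>2))"
proof -
  have "2 \<le> k" using assms(3) by simp
  then show ?thesis
    using assms frac_metric_dim_johnson_graph_4_2[of X] frac_metric_dim_johnson_graph_8_4[of X]
      frac_metric_dim_johnson_graph_generic[of X n k]
    by auto
qed

end
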